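(* Let $(f^{(1)},f^{(2)})$ be an optimal solution of the reduced optimal transport problem (R) defined in the context. Then the output $\pi$ of the Reconstruction Algorithm defined in the context, applied to the input $(f^{(1)},f^{(2)})$, is an optimal solution of the optimal transport problem (OT) defined in the context.
   Context: Let $m,n$ be positive integers and $\mathcal I=\{(i,j): 1\le i\le m,\ 1\le j\le n\}$. Let $\mu^1,\mu^2$ be two histograms on $\mathcal I$, i.e. $\mu^s=(\mu^s_{i,j})_{(i,j)\in\mathcal I}$ with $\mu^s_{i,j}\ge 0$ and $\sum_{(i,j)\in\mathcal I}\mu^s_{i,j}=1$ for $s=1,2$. Problem (OT): minimize $\sum_{(i,j)\in\mathcal I}\sum_{(k,l)\in\mathcal I}c_{i,j;k,l}\,\pi_{i,j;k,l}$ over real arrays $\pi=(\pi_{i,j;k,l})$, where $c_{i,j;k,l}=(i-k)^2+(j-l)^2$, subject to $\sum_{(k,l)\in\mathcal I}\pi_{i,j;k,l}=\mu^1_{i,j}$ for all $(i,j)\in\mathcal I$, $\sum_{(i,j)\in\mathcal I}\pi_{i,j;k,l}=\mu^2_{k,l}$ for all $(k,l)\in\mathcal I$, and $\pi_{i,j;k,l}\ge 0$ for all $(i,j),(k,l)\in\mathcal I$. Problem (R): minimize $$\sum_{(i,j)\in\mathcal I}\sum_{k=1}^m (k-i)^2 f^{(1)}_{i,k,j}+\sum_{(k,j)\in\mathcal I}\sum_{l=1}^n (j-l)^2 f^{(2)}_{k,j,l}$$ over real arrays $f^{(1)}=(f^{(1)}_{i,k,j})_{1\le i,k\le m,\,1\le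 j\le n}$ and $f^{(2)}=(f^{(2)}_{k,j,l})_{1\le k\le m,\,1\le j,l\le n}$, subject to $\sum_{i=1}^m f^{(1)}_{i,k,j}=\sum_{l=1}^n f^{(2)}_{k,j,l}$ for all $(k,j)\in\mathcal I$; $\sum_{k=1}^m f^{(1)}_{i,k,j}=\mu^1_{i,j}$ for all $(i,j)\in\mathcal I$; $\sum_{j=1}^n f^{(2)}_{k,j,l}=\mu^2_{k,l}$ for all $(k,l)\in\mathcal I$; and $f^{(1)}_{i,k,j}\ge 0$, $f^{(2)}_{k,j,l}\ge0$ for all indices. Reconstruction Algorithm: given $(f^{(1)},f^{(2)})$, for each $(k,j)\in\mathcal I$ (outer loop), for $i=1,\dots,m$ (middle loop), for $l=1,\dots,n$ (inner loop), perform successively the assignments (the arrays $f^{(1)},f^{(2)}$ being overwritten in place): $\pi_{i,j;k,l}\leftarrow\min\{f^{(1)}_{i,k,j},f^{(2)}_{k,j,l}\}$; $f^{(1)}_{i,k,j}\leftarrow f^{(1)}_{i,k,j}-\pi_{i,j;k,l}$; $f^{(2)}_{k,j,l}\leftarrow f^{(2)}_{k,j,l}-\pi_{i,j;k,l}$. The output is $\pi=(\pi_{i,j;k,l})$. *)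

theory Defs
  imports Complex_Main
begin

text \<open>
  Arrays are total functions on index tuples. Only their values at indices in range
  occur in constraints and objectives; values elsewhere are irrelevant.
\<close>

definition grid :: "nat \<Rightarrow> nat \<Rightarrow> (nat \<times> nat) set" where
  "grid m n = {1..m} \<times> {1..n}"

definition histogram :: "nat \<Rightarrow> nat \<Rightarrow> (nat \<times> nat \<Rightarrow> real) \<Rightarrow> bool" where
  "histogram m n \<mu> \<longleftrightarrow> (\<forall>p\<in>grid m n. 0 \<le> \<mu> p) \<and> (\<Sum>p\<in>grid m n. \<mu> p) = 1"


subsection \<open>The optimal transport problem\<close>

type_synonym plan = "(nat \<times> nat) \<times> (nat \<times> nat) \<Rightarrow> real"

definition ot_cost :: "(nat \<times> nat) \<times> (nat \<times> nat) \<Rightarrow> real" where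
  "ot_cost = (\<lambda>((i, j), (k, l)). (real i - real k)\<^sup>2 + (real j - real l)\<^sup>2)"

definition ot_objective :: "nat \<Rightarrow> nat \<Rightarrow> plan \<Rightarrow> real" where
  "ot_objective m n \<pi> =
     (\<Sum>(i, j)\<in>grid m n. \<Sum>(k, l)\<in>grid m n. ot_cost ((i, j), (k, l)) * \<pi> ((i, j), (k, l)))"

definition ot_feasible ::
  "nat \<Rightarrow> nat \<Rightarrow> (nat \<times> nat \<Rightarrow> real) \<Rightarrow> (nat \<times> nat \<Rightarrow> real) \<Rightarrow> plan \<Rightarrow> bool" where
  "ot_feasible m n \<mu>1 \<mu>2 \<pi> \<longleftrightarrow>
     (\<forall>(i, j)\<in>grid m n. (\<Sum>(k, l)\<in>grid m n. \<pi> ((i, j), (k, l))) = \<mu>1 (i, j)) \<and>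
     (\<forall>(k, l)\<in>grid m n. (\<Sum>(i, j)\<in>grid m n. \<pi> ((i, j), (k, l))) = \<mu>2 (k, l)) \<and>
     (\<forall>(i, j)\<in>grid m n. \<forall>(k, l)\<in>grid m n. 0 \<le> \<pi> ((i, j), (k, l)))"

definition ot_optimal ::
  "nat \<Rightarrow> nat \<Rightarrow> (nat \<times> nat \<Rightarrow> real) \<Rightarrow> (nat \<times> nat \<Rightarrow> real) \<Rightarrow> plan \<Rightarrow> bool" where
  "ot_optimal m n \<mu>1 \<mu>2 \<pi> \<longleftrightarrow>
     ot_feasible m n \<mu>1 \<mu>2 \<pi> \<and>
     (\<forall>\<pi>'. ot_feasible m n \<mu>1 \<mu>2 \<pi>' \<longrightarrow> ot_objective m n \<pi> \<le> ot_objective m n \<pi>')"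


subsection \<open>The reduced problem\<close>

text \<open>The first flow is indexed by \<open>(i, k, j)\<close>, the second by \<open>(k, j, l)\<close>.\<close>

type_synonym flow = "nat \<times> nat \<times> nat \<Rightarrow> real"

definition red_objective :: "nat \<Rightarrow> nat \<Rightarrow> flow \<Rightarrow> flow \<Rightarrow> real" where
  "red_objective m n f1 f2 =
     (\<Sum>(i, j)\<in>grid m n. \<Sum>k=1..m. (real k - real i)\<^sup>2 * f1 (i, k, j)) +
     (\<Sum>(k, j)\<in>grid m n. \<Sum>l=1..n. (real j - real l)\<^sup>2 * f2 (k, j, l))"

definition red_feasible ::
  "nat \<Rightarrow> nat \<Rightarrow> (nat \<times> nat \<Rightarrow> real) \<Rightarrow> (nat \<times> nat \<Rightarrow> real) \<Rightarrow> flow \<Rightarrow> flow \<Rightarrow> bool" where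
  "red_feasible m n \<mu>1 \<mu>2 f1 f2 \<longleftrightarrow>
     (\<forall>(k, j)\<in>grid m n. (\<Sum>i=1..m. f1 (i, k, j)) = (\<Sum>l=1..n. f2 (k, j, l))) \<and>
     (\<forall>(i, j)\<in>grid m n. (\<Sum>k=1..m. f1 (i, k, j)) = \<mu>1 (i, j)) \<and>
     (\<forall>(k, l)\<in>grid m n. (\<Sum>j=1..n. f2 (k, j, l)) = \<mu>2 (k, l)) \<and>
     (\<forall>i\<in>{1..m}. \<forall>k\<in>{1..m}. \<forall>j\<in>{1..n}. 0 \<le> f1 (i, k, j)) \<and>
     (\<forall>k\<in>{1..m}. \<forall>j\<in>{1..n}. \<forall>l\<in>{1..n}. 0 \<le> f2 (k, j, l))"

definition red_optimal ::
  "nat \<Rightarrow> nat \<Rightarrow> (nat \<times> nat \<Rightarrow> real) \<Rightarrow> (nat \<times> nat \<Rightarrow> real) \<Rightarrow> flow \<Rightarrow> flow \<Rightarrow> bool" where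
  "red_optimal m n \<mu>1 \<mu>2 f1 f2 \<longleftrightarrow>
     red_feasible m n \<mu>1 \<mu>2 f1 f2 \<and>
     (\<forall>g1 g2. red_feasible m n \<mu>1 \<mu>2 g1 g2 \<longrightarrow>
        red_objective m n f1 f2 \<le> red_objective m n g1 g2)"


subsection \<open>The reconstruction algorithm\<close>

type_synonym rstate = "flow \<times> flow \<times> plan"

definition rec_step :: "nat \<Rightarrow> nat \<Rightarrow> nat \<Rightarrow> nat \<Rightarrow> rstate \<Rightarrow> rstate" where
  "rec_step k j i l = (\<lambda>(f1, f2, \<pi>).
     let \<pi>' = \<pi> (((i, j), (k, l)) := min (f1 (i, k, j)) (f2 (k, j, l)));
         f1' = f1 ((i, k, j) := f1 (i, k, j) - \<pi>' ((i, j), (k, l)));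
         f2' = f2 ((k, j, l) := f2 (k, j, l) - \<pi>' ((i, j), (k, l)))
     in (f1', f2', \<pi>'))"

definition rec_cell :: "nat \<Rightarrow> nat \<Rightarrow> nat \<times> nat \<Rightarrow> rstate \<Rightarrow> rstate" where
  "rec_cell m n = (\<lambda>(k, j).
     fold (\<lambda>i. fold (\<lambda>l. rec_step k j i l) [1..<n+1]) [1..<m+1])"

text \<open>
  The list \<open>kjs\<close> is the order in which the outer loop visits the cells \<open>(k, j)\<close>, and
  \<open>\<pi>0\<close> is the content of the output array before the run.
\<close>

definition reconstruct ::
  "nat \<Rightarrow> nat \<Rightarrow> (nat \<times> nat) list \<Rightarrow> plan \<Rightarrow> flow \<Rightarrow> flow \<Rightarrow> plan" where
  "reconstruct m n kjs \<pi>0 f1 f2 = snd (snd (fold (rec_cell m n) kjs (f1, f2, \<pi>0)))"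

end

theory Submission
  imports Defs
begin

text \<open>
  Summing a plan over its last coordinate, respectively its first one, gives a pair of flows that
  is feasible for (R) exactly when the nonnegative plan is feasible for (OT), with the same
  objective, since the cost splits into a horizontal and a vertical part. It remains to see that
  the algorithm inverts this map, i.e. that its output has the given flows as marginals. Every
  visit to \<open>((i, j), (k, l))\<close> annihilates one of the residuals \<open>f1 (i, k, j)\<close> and \<open>f2 (k, j, l)\<close>,
  and residuals stay nonnegative and never increase. So at the end, for each \<open>(k, j)\<close>, one of the
  two families of residuals vanishes identically; their sums being equal, both vanish.
\<close>

section \<open>Plans and the pairs of flows they induce\<close>

definition marginal1 :: "nat \<Rightarrow> plan \<Rightarrow> flow" where
  "marginal1 n \<pi> = (\<lambda>(i, k, j). \<Sum>l=1..n. \<pi> ((i, j), (k, l)))"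

definition marginal2 :: "nat \<Rightarrow> plan \<Rightarrow> flow" where
  "marginal2 m \<pi> = (\<lambda>(k, j, l). \<Sum>i=1..m. \<pi> ((i, j), (k, l)))"

lemma sum_grid: "(\<Sum>p\<in>grid m n. f p) = (\<Sum>i=1..m. \<Sum>j=1..n. f (i, j))"
  unfolding grid_def by (simp add: sum.cartesian_product)

lemma ot_objective_eq_red_objective:
  "ot_objective m n \<pi> = red_objective m n (marginal1 n \<pi>) (marginal2 m \<pi>)"
proof -
  have split: "ot_objective m n \<pi> =
      (\<Sum>i=1..m. \<Sum>j=1..n. \<Sum>k=1..m. \<Sum>l=1..n. (real k - real i)\<^sup>2 * \<pi> ((i, j), (k, l))) +
      (\<Sum>i=1..m. \<Sum>j=1..n. \<Sum>k=1..m. \<Sum>l=1..n. (real j - real l)\<^sup>2 * \<pi> ((i, j), (k, l)))"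
    by (simp add: ot_objective_def ot_cost_def sum_grid distrib_right sum.distrib power2_commute)
  \<comment> \<open>Only the vertical part needs reordering: in the horizontal part \<open>l\<close>
    is already innermost, as in \<open>marginal1\<close>. The swaps bring \<open>k\<close>,
    \<open>j\<close>, \<open>l\<close> to the front and leave \<open>i\<close> innermost, as in
    \<open>marginal2\<close>.\<close>
  have "(\<Sum>i=1..m. \<Sum>j=1..n. \<Sum>k=1..m. \<Sum>l=1..n. (real j - real l)\<^sup>2 * \<pi> ((i, j), (k, l))) =
      (\<Sum>i=1..m. \<Sum>k=1..m. \<Sum>j=1..n. \<Sum>l=1..n. (real j - real l)\<^sup>2 * \<pi> ((i, j), (k, l)))"
    by (intro sum.cong refl sum.swap)
  also have "\<dots> =
      (\<Sum>k=1..m. \<Sum>i=1..m. \<Sum>j=1..n. \<Sum>l=1..n. (real j - real l)\<^sup>2 * \<pi> ((i, j), (k, l)))"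
    by (rule sum.swap)
  also have "\<dots> =
      (\<Sum>k=1..m. \<Sum>j=1..n. \<Sum>i=1..m. \<Sum>l=1..n. (real j - real l)\<^sup>2 * \<pi> ((i, j), (k, l)))"
    by (intro sum.cong refl sum.swap)
  also have "\<dots> =
      (\<Sum>k=1..m. \<Sum>j=1..n. \<Sum>l=1..n. \<Sum>i=1..m. (real j - real l)\<^sup>2 * \<pi> ((i, j), (k, l)))"
    by (intro sum.cong refl sum.swap)
  finally show ?thesis
    unfolding split red_objective_def marginal1_def marginal2_def sum_grid prod.case sum_distrib_left
    by (rule arg_cong)
qed

text \<open>Values of flows out of range are arbitrary, so the marginals of the output are compared
  with the given flows in range only. This congruence rule and the next one transfer objective and
  feasibility along such a comparison.\<close>

lemma red_objective_cong:
  assumes "\<And>i k j. i \<in> {1..m} \<Longrightarrow> k \<in> {1..m} \<Longrightarrow> j \<in> {1..n} \<Longrightarrow> f1 (i, k, j) = g1 (i, k, j)"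
    and "\<And>k j l. k \<in> {1..m} \<Longrightarrow> j \<in> {1..n} \<Longrightarrow> l \<in> {1..n} \<Longrightarrow> f2 (k, j, l) = g2 (k, j, l)"
  shows "red_objective m n f1 f2 = red_objective m n g1 g2"
  unfolding red_objective_def sum_grid
  by (intro arg_cong2[where f = "(+)"] sum.cong refl) (simp_all add: assms)

lemma red_feasible_cong:
  assumes "red_feasible m n \<mu>1 \<mu>2 f1 f2"
    and f1: "\<And>i k j. i \<in> {1..m} \<Longrightarrow> k \<in> {1..m} \<Longrightarrow> j \<in> {1..n} \<Longrightarrow> g1 (i, k, j) = f1 (i, k, j)"
    and f2: "\<And>k j l. k \<in> {1..m} \<Longrightarrow> j \<in> {1..n} \<Longrightarrow> l \<in> {1..n} \<Longrightarrow> g2 (k, j, l) = f2 (k, j, l)"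
  shows "red_feasible m n \<mu>1 \<mu>2 g1 g2"
proof -
  have "(\<Sum>i=1..m. g1 (i, k, j)) = (\<Sum>i=1..m. f1 (i, k, j))"
    and "(\<Sum>l=1..n. g2 (k, j, l)) = (\<Sum>l=1..n. f2 (k, j, l))"
    and "(\<Sum>k'=1..m. g1 (k, k', j)) = (\<Sum>k'=1..m. f1 (k, k', j))"
    and "(\<Sum>j'=1..n. g2 (k, j', j)) = (\<Sum>j'=1..n. f2 (k, j', j))"
    if "k \<in> {1..m}" "j \<in> {1..n}" for k j
    using that by (auto intro!: sum.cong f1 f2)
  then show ?thesis
    using assms by (simp add: red_feasible_def grid_def)
qed

text \<open>The balance constraint of (R) holds for marginals of any plan: at fixed
  \<open>(k, j)\<close> both sides sum the plan over \<open>i\<close> and \<open>l\<close>.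
  Nonnegativity of the plan stands apart because in general it does not follow from that of its
  marginals.\<close>

lemma ot_feasible_iff_red_feasible:
  "ot_feasible m n \<mu>1 \<mu>2 \<pi> \<longleftrightarrow>
     red_feasible m n \<mu>1 \<mu>2 (marginal1 n \<pi>) (marginal2 m \<pi>) \<and>
     (\<forall>(i, j)\<in>grid m n. \<forall>(k, l)\<in>grid m n. 0 \<le> \<pi> ((i, j), (k, l)))"
proof -
  have "(\<Sum>i=1..m. \<Sum>l=1..n. \<pi> ((i, j), (k, l))) = (\<Sum>l=1..n. \<Sum>i=1..m. \<pi> ((i, j), (k, l)))"
    and "(\<Sum>i=1..m. \<Sum>j=1..n. \<pi> ((i, j), (k, l))) = (\<Sum>j=1..n. \<Sum>i=1..m. \<pi> ((i, j), (k, l)))"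
    for k j l by (rule sum.swap)+
  then show ?thesis
    unfolding ot_feasible_def red_feasible_def sum_grid
    by (auto simp: marginal1_def marginal2_def grid_def intro!: sum_nonneg)
qed

section \<open>The nested loops as one pass over a list\<close>

lemma fold_product:
  "fold f (List.product xs ys) s = fold (\<lambda>x. fold (\<lambda>y. f (x, y)) ys) xs s"
  by (induction xs arbitrary: s) (simp_all add: fold_map comp_def)

text \<open>Flattening keeps the order of the three loops and allows the invariant to be proved by
  induction along a single list.\<close>

definition visits :: "nat \<Rightarrow> nat \<Rightarrow> (nat \<times> nat) list \<Rightarrow> ((nat \<times> nat) \<times> (nat \<times> nat)) list" where
  "visits m n kjs =
     map (\<lambda>((k, j), (i, l)). ((i, j), (k, l))) (List.product kjs (List.product [1..<m+1] [1..<n+1]))"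

definition visit :: "(nat \<times> nat) \<times> (nat \<times> nat) \<Rightarrow> rstate \<Rightarrow> rstate" where
  "visit = (\<lambda>((i, j), (k, l)). rec_step k j i l)"

lemma reconstruct_eq_fold_visit:
  "reconstruct m n kjs \<pi>0 f1 f2 = snd (snd (fold visit (visits m n kjs) (f1, f2, \<pi>0)))"
proof -
  have "rec_cell m n = (\<lambda>kj.
      fold (\<lambda>il. visit ((fst il, snd kj), (fst kj, snd il))) (List.product [1..<m+1] [1..<n+1]))"
    by (simp add: fun_eq_iff fold_product rec_cell_def visit_def)
  then show ?thesis
    by (simp add: reconstruct_def visits_def fold_map fold_product comp_def split_beta del: upt_Suc)
qed

text \<open>This ensures that no recorded amount is overwritten: after the first visit one of the
  two residuals is 0, so a second visit would store 0.\<close>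

lemma distinct_visits: "distinct kjs \<Longrightarrow> distinct (visits m n kjs)"
  unfolding visits_def
  by (auto simp: distinct_map distinct_product inj_on_def simp del: upt_Suc)

lemma set_visits: "set kjs = grid m n \<Longrightarrow> set (visits m n kjs) = grid m n \<times> grid m n"
  unfolding visits_def grid_def by (force simp del: upt_Suc)

section \<open>The loop invariant\<close>

text \<open>Masking discards the arbitrary initial content of the output array.\<close>
definition visited_part :: "((nat \<times> nat) \<times> (nat \<times> nat)) set \<Rightarrow> plan \<Rightarrow> plan" where
  "visited_part V \<pi> = (\<lambda>q. if q \<in> V then \<pi> q else 0)"

text \<open>\<open>V\<close> collects the entries visited so far, \<open>f1\<close> and
  \<open>f2\<close> are the input flows, \<open>g1\<close> and \<open>g2\<close> the current
  residuals. The equations express conservation of mass; the final disjunction is the trace left by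
  each \<open>min\<close>.\<close>

definition rec_invariant ::
  "nat \<Rightarrow> nat \<Rightarrow> flow \<Rightarrow> flow \<Rightarrow> ((nat \<times> nat) \<times> (nat \<times> nat)) set \<Rightarrow> rstate \<Rightarrow> bool" where
  "rec_invariant m n f1 f2 V = (\<lambda>(g1, g2, \<pi>).
     (\<forall>q\<in>V. 0 \<le> \<pi> q) \<and>
     (\<forall>i\<in>{1..m}. \<forall>k\<in>{1..m}. \<forall>j\<in>{1..n}. 0 \<le> g1 (i, k, j) \<and>
        f1 (i, k, j) = g1 (i, k, j) + marginal1 n (visited_part V \<pi>) (i, k, j)) \<and>
     (\<forall>k\<in>{1..m}. \<forall>j\<in>{1..n}. \<forall>l\<in>{1..n}. 0 \<le> g2 (k, j, l) \<and>
        f2 (k, j, l) = g2 (k, j, l) + marginal2 m (visited_part V \<pi>) (k, j, l)) \<and>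
     (\<forall>i j k l. ((i, j), (k, l)) \<in> V \<longrightarrow> g1 (i, k, j) = 0 \<or> g2 (k, j, l) = 0))"

lemma marginal1_update:
  assumes "l \<in> {1..n}"
  shows "marginal1 n (\<rho>(((i, j), (k, l)) := x)) =
    (marginal1 n \<rho>)((i, k, j) := marginal1 n \<rho> (i, k, j) - \<rho> ((i, j), (k, l)) + x)"
  using assms by (auto simp: marginal1_def fun_eq_iff sum.delta_remove sum_diff1 intro!: sum.cong)

lemma marginal2_update:
  assumes "i \<in> {1..m}"
  shows "marginal2 m (\<rho>(((i, j), (k, l)) := x)) =
    (marginal2 m \<rho>)((k, j, l) := marginal2 m \<rho> (k, j, l) - \<rho> ((i, j), (k, l)) + x)"
  using assms by (auto simp: marginal2_def fun_eq_iff sum.delta_remove sum_diff1 intro!: sum.cong)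

text \<open>The amount \<delta> leaves one residual of each flow and enters an entry not counted
  before, which preserves both balances. Being the minimum of the two residuals, it leaves them
  nonnegative.\<close>

lemma rec_invariant_visit:
  assumes inv: "rec_invariant m n f1 f2 V s"
    and q: "q \<in> grid m n \<times> grid m n" "q \<notin> V"
  shows "rec_invariant m n f1 f2 (insert q V) (visit q s)"
proof -
  obtain g1 g2 \<pi> where s: "s = (g1, g2, \<pi>)" by (cases s)
  obtain i j k l where q_eq: "q = ((i, j), (k, l))" by (metis surj_pair)
  define \<delta> where "\<delta> = min (g1 (i, k, j)) (g2 (k, j, l))"
  define \<rho> where "\<rho> = visited_part V \<pi>"
  let ?g1 = "g1((i, k, j) := g1 (i, k, j) - \<delta>)" and ?g2 = "g2((k, j, l) := g2 (k, j, l) - \<delta>)"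
  have range: "i \<in> {1..m}" "j \<in> {1..n}" "k \<in> {1..m}" "l \<in> {1..n}"
    using q(1) unfolding q_eq grid_def by blast+
  have part: "visited_part (insert q V) (\<pi>(q := \<delta>)) = \<rho>(((i, j), (k, l)) := \<delta>)"
    unfolding \<rho>_def q_eq visited_part_def by (rule ext) simp
  \<comment> \<open>Since \<open>q\<close> is new, its masked value is 0, so the update raises the
    affected marginals by exactly \<delta>, whatever the array held there.\<close>
  have unvisited: "\<rho> ((i, j), (k, l)) = 0"
    using q(2) by (simp add: \<rho>_def q_eq visited_part_def)
  have after: "visit q s = (?g1, ?g2, \<pi>(q := \<delta>))"
    by (simp add: visit_def rec_step_def q_eq s \<delta>_def Let_def)
  have nonneg: "\<forall>q\<in>V. 0 \<le> \<pi> q"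
    and res1: "\<forall>i\<in>{1..m}. \<forall>k\<in>{1..m}. \<forall>j\<in>{1..n}. 0 \<le> g1 (i, k, j) \<and>
        f1 (i, k, j) = g1 (i, k, j) + marginal1 n \<rho> (i, k, j)"
    and res2: "\<forall>k\<in>{1..m}. \<forall>j\<in>{1..n}. \<forall>l\<in>{1..n}. 0 \<le> g2 (k, j, l) \<and>
        f2 (k, j, l) = g2 (k, j, l) + marginal2 m \<rho> (k, j, l)"
    and zero: "\<forall>i j k l. ((i, j), (k, l)) \<in> V \<longrightarrow> g1 (i, k, j) = 0 \<or> g2 (k, j, l) = 0"
    using inv unfolding rec_invariant_def s split_conv \<rho>_def by blast+
  have "0 \<le> g1 (i, k, j)" "0 \<le> g2 (k, j, l)"
    using res1 res2 range by blast+
  then have \<delta>: "0 \<le> \<delta>" "\<delta> \<le> g1 (i, k, j)" "\<delta> \<le> g2 (k, j, l)"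
      "g1 (i, k, j) = \<delta> \<or> g2 (k, j, l) = \<delta>"
      "g1 (i, k, j) = 0 \<Longrightarrow> \<delta> = 0" "g2 (k, j, l) = 0 \<Longrightarrow> \<delta> = 0"
    by (auto simp: \<delta>_def)
  have 1: "\<forall>p\<in>insert q V. 0 \<le> (\<pi>(q := \<delta>)) p"
    using nonneg \<delta>(1) by simp
  have 2: "\<forall>i'\<in>{1..m}. \<forall>k'\<in>{1..m}. \<forall>j'\<in>{1..n}. 0 \<le> ?g1 (i', k', j') \<and>
      f1 (i', k', j') = ?g1 (i', k', j') +
        marginal1 n (\<rho>(((i, j), (k, l)) := \<delta>)) (i', k', j')"
    unfolding marginal1_update[OF range(4)] unvisited using res1 \<delta>(2) by simp
  have 3: "\<forall>k'\<in>{1..m}. \<forall>j'\<in>{1..n}. \<forall>l'\<in>{1..n}. 0 \<le> ?g2 (k', j', l') \<and>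
      f2 (k', j', l') = ?g2 (k', j', l') +
        marginal2 m (\<rho>(((i, j), (k, l)) := \<delta>)) (k', j', l')"
    unfolding marginal2_update[OF range(1)] unvisited using res2 \<delta>(3) by simp
  \<comment> \<open>At \<open>q\<close> itself the minimum empties one residual. An older zero can
    only be touched by subtracting \<delta> from it, and then \<delta> is 0.\<close>
  have 4: "\<forall>i' j' k' l'. ((i', j'), (k', l')) \<in> insert q V \<longrightarrow>
      ?g1 (i', k', j') = 0 \<or> ?g2 (k', j', l') = 0"
  proof (intro allI impI)
    fix i' j' k' l'
    assume "((i', j'), (k', l')) \<in> insert q V"
    then consider "((i', j'), (k', l')) = ((i, j), (k, l))"
      | "g1 (i', k', j') = 0 \<or> g2 (k', j', l') = 0"
      using zero unfolding q_eq by blast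
    then show "?g1 (i', k', j') = 0 \<or> ?g2 (k', j', l') = 0"
      by cases (use \<delta>(4-6) in auto)
  qed
  show ?thesis
    unfolding after rec_invariant_def split_conv part
    by (rule conjI[OF 1 conjI[OF 2 conjI[OF 3 4]]])
qed

lemma rec_invariant_fold_visit:
  assumes "red_feasible m n \<mu>1 \<mu>2 f1 f2"
    and "distinct qs" and "set qs \<subseteq> grid m n \<times> grid m n"
  shows "rec_invariant m n f1 f2 (set qs) (fold visit qs (f1, f2, \<pi>0))"
  using assms(2,3)
proof (induction qs rule: rev_induct)
  \<comment> \<open>Before the first visit the masked plan is zero for every \<open>\<pi>0\<close>,
    so only nonnegativity of the input flows has to be checked.\<close>
  case Nil
  then show ?case
    using assms(1)
    by (simp add: rec_invariant_def red_feasible_def marginal1_def marginal2_def visited_part_def)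
next
  case (snoc q qs)
  then show ?case
    using rec_invariant_visit[of m n f1 f2 "set qs" "fold visit qs (f1, f2, \<pi>0)" q] by simp
qed

section \<open>Vanishing of the final residuals\<close>

text \<open>A single nonzero \<open>a x\<close> forces all of \<open>b\<close> to vanish on
  \<open>B\<close>, so one of the sums is 0, hence both are; nonnegative terms with sum 0
  vanish.\<close>

lemma balanced_residuals_vanish:
  fixes a b :: "'a \<Rightarrow> real"
  assumes "finite A" "finite B" "sum a A = sum b B"
    and "\<And>x. x \<in> A \<Longrightarrow> 0 \<le> a x" "\<And>y. y \<in> B \<Longrightarrow> 0 \<le> b y"
    and "\<And>x y. x \<in> A \<Longrightarrow> y \<in> B \<Longrightarrow> a x = 0 \<or> b y = 0"
  shows "(\<forall>x\<in>A. a x = 0) \<and> (\<forall>y\<in>B. b y = 0)"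
proof -
  have "sum a A = 0 \<or> sum b B = 0"
    using assms(6) by (meson sum.neutral)
  then show ?thesis
    using assms sum_nonneg_eq_0_iff[of A a] sum_nonneg_eq_0_iff[of B b] by auto
qed

lemma reconstruct_marginals:
  fixes f1 f2 :: flow and \<pi>0 :: plan
  assumes feas: "red_feasible m n \<mu>1 \<mu>2 f1 f2"
    and kjs: "set kjs = grid m n" "distinct kjs"
  defines "\<pi> \<equiv> reconstruct m n kjs \<pi>0 f1 f2"
  shows "q \<in> grid m n \<times> grid m n \<Longrightarrow> 0 \<le> \<pi> q"
    and "i \<in> {1..m} \<Longrightarrow> k \<in> {1..m} \<Longrightarrow> j \<in> {1..n} \<Longrightarrow> marginal1 n \<pi> (i, k, j) = f1 (i, k, j)"
    and "k \<in> {1..m} \<Longrightarrow> j \<in> {1..n} \<Longrightarrow> l \<in> {1..n} \<Longrightarrow> marginal2 m \<pi> (k, j, l) = f2 (k, j, l)"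
proof -
  let ?V = "grid m n \<times> grid m n"
  obtain g1 g2 where run: "fold visit (visits m n kjs) (f1, f2, \<pi>0) = (g1, g2, \<pi>)"
    unfolding \<pi>_def reconstruct_eq_fold_visit by (metis prod.collapse)
  have inv: "rec_invariant m n f1 f2 ?V (g1, g2, \<pi>)"
    using rec_invariant_fold_visit[OF feas distinct_visits[OF kjs(2)], of m n \<pi>0]
    by (simp add: set_visits[OF kjs(1)] run)
  have nonneg: "\<forall>q\<in>?V. 0 \<le> \<pi> q"
    and res1: "\<forall>i\<in>{1..m}. \<forall>k\<in>{1..m}. \<forall>j\<in>{1..n}. 0 \<le> g1 (i, k, j) \<and>
        f1 (i, k, j) = g1 (i, k, j) + marginal1 n (visited_part ?V \<pi>) (i, k, j)"
    and res2: "\<forall>k\<in>{1..m}. \<forall>j\<in>{1..n}. \<forall>l\<in>{1..n}. 0 \<le> g2 (k, j, l) \<and>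
        f2 (k, j, l) = g2 (k, j, l) + marginal2 m (visited_part ?V \<pi>) (k, j, l)"
    and zero: "\<forall>i j k l. ((i, j), (k, l)) \<in> ?V \<longrightarrow> g1 (i, k, j) = 0 \<or> g2 (k, j, l) = 0"
    using inv unfolding rec_invariant_def split_conv by blast+
  show "q \<in> ?V \<Longrightarrow> 0 \<le> \<pi> q"
    using nonneg by blast
  have marginal1: "marginal1 n (visited_part ?V \<pi>) (i, k, j) = marginal1 n \<pi> (i, k, j)"
    if "i \<in> {1..m}" "k \<in> {1..m}" "j \<in> {1..n}" for i k j
    using that by (simp add: marginal1_def visited_part_def grid_def)
  have marginal2: "marginal2 m (visited_part ?V \<pi>) (k, j, l) = marginal2 m \<pi> (k, j, l)"
    if "k \<in> {1..m}" "j \<in> {1..n}" "l \<in> {1..n}" for k j l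
    using that by (simp add: marginal2_def visited_part_def grid_def)
  have res1: "0 \<le> g1 (i, k, j)" "f1 (i, k, j) = g1 (i, k, j) + marginal1 n \<pi> (i, k, j)"
    if "i \<in> {1..m}" "k \<in> {1..m}" "j \<in> {1..n}" for i k j
    using res1 that unfolding marginal1[OF that, symmetric] by blast+
  have res2: "0 \<le> g2 (k, j, l)" "f2 (k, j, l) = g2 (k, j, l) + marginal2 m \<pi> (k, j, l)"
    if "k \<in> {1..m}" "j \<in> {1..n}" "l \<in> {1..n}" for k j l
    using res2 that unfolding marginal2[OF that, symmetric] by blast+
  have vanish: "(\<forall>i\<in>{1..m}. g1 (i, k, j) = 0) \<and> (\<forall>l\<in>{1..n}. g2 (k, j, l) = 0)"
    if kj: "k \<in> {1..m}" "j \<in> {1..n}" for k j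
  proof (rule balanced_residuals_vanish)
    \<comment> \<open>The inputs are balanced at \<open>(k, j)\<close>, and the same mass, the plan
      summed over \<open>i\<close> and \<open>l\<close>, has been removed from both sides; so the
      residuals are balanced too.\<close>
    have "(\<Sum>i=1..m. f1 (i, k, j)) = (\<Sum>l=1..n. f2 (k, j, l))"
      using feas kj by (auto simp: red_feasible_def grid_def)
    moreover have "(\<Sum>i=1..m. f1 (i, k, j)) =
        (\<Sum>i=1..m. g1 (i, k, j)) + (\<Sum>i=1..m. \<Sum>l=1..n. \<pi> ((i, j), (k, l)))"
      using res1(2) kj by (simp add: marginal1_def flip: sum.distrib)
    moreover have "(\<Sum>l=1..n. f2 (k, j, l)) =
        (\<Sum>l=1..n. g2 (k, j, l)) + (\<Sum>l=1..n. \<Sum>i=1..m. \<pi> ((i, j), (k, l)))"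
      using res2(2) kj by (simp add: marginal2_def flip: sum.distrib)
    ultimately show "(\<Sum>i=1..m. g1 (i, k, j)) = (\<Sum>l=1..n. g2 (k, j, l))"
      using sum.swap[of "\<lambda>i l. \<pi> ((i, j), (k, l))" "{1..n}" "{1..m}"] by simp
    show "g1 (i, k, j) = 0 \<or> g2 (k, j, l) = 0" if "i \<in> {1..m}" "l \<in> {1..n}" for i l
      using zero that kj by (simp add: grid_def)
  qed (use kj in \<open>auto intro: res1(1) res2(1)\<close>)
  show "i \<in> {1..m} \<Longrightarrow> k \<in> {1..m} \<Longrightarrow> j \<in> {1..n} \<Longrightarrow> marginal1 n \<pi> (i, k, j) = f1 (i, k, j)"
    and "k \<in> {1..m} \<Longrightarrow> j \<in> {1..n} \<Longrightarrow> l \<in> {1..n} \<Longrightarrow> marginal2 m \<pi> (k, j, l) = f2 (k, j, l)"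
    using vanish res1(2)[of i k j] res2(2)[of k j l] by auto
qed

theorem proposition1:
  fixes m n :: nat
    and \<mu>1 \<mu>2 :: "nat \<times> nat \<Rightarrow> real"
    and f1 f2 :: flow
    and kjs :: "(nat \<times> nat) list"
    and \<pi>0 :: plan
  assumes "m \<ge> 1" and "n \<ge> 1"
    and "histogram m n \<mu>1" and "histogram m n \<mu>2"
    and "red_optimal m n \<mu>1 \<mu>2 f1 f2"
    and "set kjs = grid m n" and "distinct kjs"
  shows "ot_optimal m n \<mu>1 \<mu>2 (reconstruct m n kjs \<pi>0 f1 f2)"
proof -
  define \<pi> where "\<pi> = reconstruct m n kjs \<pi>0 f1 f2"
  have feas: "red_feasible m n \<mu>1 \<mu>2 f1 f2"
    using assms(5) by (simp add: red_optimal_def)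
  note marginals = reconstruct_marginals[OF feas assms(6,7), where ?\<pi>0.0 = \<pi>0, folded \<pi>_def]
  have "red_feasible m n \<mu>1 \<mu>2 (marginal1 n \<pi>) (marginal2 m \<pi>)"
    using feas marginals(2,3) by (rule red_feasible_cong)
  then have "ot_feasible m n \<mu>1 \<mu>2 \<pi>"
    using marginals(1) by (auto simp: ot_feasible_iff_red_feasible)
  moreover have "ot_objective m n \<pi> \<le> ot_objective m n \<pi>'"
    if "ot_feasible m n \<mu>1 \<mu>2 \<pi>'" for \<pi>'
  proof -
    have "ot_objective m n \<pi> = red_objective m n f1 f2"
      unfolding ot_objective_eq_red_objective using marginals(2,3) by (rule red_objective_cong)
    \<comment> \<open>Every competing plan has marginals feasible for (R), and the given flows are
      optimal there.\<close>
    also have "\<dots> \<le> red_objective m n (marginal1 n \<pi>') (marginal2 m \<pi>')"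
      using assms(5) that by (simp add: red_optimal_def ot_feasible_iff_red_feasible)
    finally show ?thesis
      by (simp add: ot_objective_eq_red_objective)
  qed
  ultimately show ?thesis
    by (simp add: ot_optimal_def \<pi>_def)
qed

end
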